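(* Let $2\leq r\leq\infty$, and let $\psi:\mathbb{F}_r\to\mathbb{R}$ be a radial function. Assume $\psi$ is conditionally negative definite with $\psi(e)=0$. Then there exists a constant $c\geq0$ such that $\psi(x)\leq c|x|$ for every $x\in\mathbb{F}_r$.
   Context: For $2\leq r\leq\infty$, $\mathbb{F}_r$ is the free group on $r$ generators (countably infinitely many if $r=\infty$), $e$ is its identity, and $|x|$ is the word length of $x\in\mathbb{F}_r$ with respect to the free generators. A function on $\mathbb{F}_r$ is radial if its value at $x$ depends only on $|x|$. A map $\psi:G\to\mathbb{C}$ on a group $G$ is conditionally negative definite if $\psi(x^{-1})=\overline{\psi(x)}$ for all $x\in G$ and $\sum_{j,k=1}^n c_j\overline{c_k}\,\psi(x_k^{-1}x_j)\leq0$ for all $n\in\mathbb{N}$, $x_1,\dots,x_n\in G$ and $c_1,\dots,c_n\in\mathbb{C}$ with $\sum_j c_j=0$. *)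

theory Defs
  imports Complex_Main "HOL-Algebra.Group" "HOL-Library.Extended_Nat" "HOL-Library.Complex_Order"
begin

text \<open>
  The free group on a set \<open>S\<close> is realised on reduced words. The letter \<open>(s, True)\<close> stands for
  the generator \<open>s\<close> and \<open>(s, False)\<close> for its inverse. The product of two reduced words is the
  reduced form of their concatenation, obtained by prepending the letters of the first word
  one at a time and cancelling whenever a letter meets its inverse.
\<close>

type_synonym 'a letter = "'a \<times> bool"

definition letter_inv :: "'a letter \<Rightarrow> 'a letter" where
  "letter_inv a = (fst a, \<not> snd a)"

definition reduced :: "'a letter list \<Rightarrow> bool" where
  "reduced = successively (\<lambda>a b. b \<noteq> letter_inv a)"

fun prepend :: "'a letter \<Rightarrow> 'a letter list \<Rightarrow> 'a letter list" where
  "prepend a [] = [a]"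
| "prepend a (b # w) = (if b = letter_inv a then w else a # b # w)"

definition mult_word :: "'a letter list \<Rightarrow> 'a letter list \<Rightarrow> 'a letter list" where
  "mult_word v w = foldr prepend v w"

definition free_group :: "'a set \<Rightarrow> 'a letter list monoid" where
  "free_group S = \<lparr>carrier = {w. reduced w \<and> fst ` set w \<subseteq> S}, mult = mult_word, one = []\<rparr>"

text \<open>
  \<open>FG r\<close> has \<open>r\<close> generators, indexed by the natural numbers below \<open>r\<close>; for \<open>r = \<infinity>\<close> these are
  all natural numbers.
\<close>

definition FG :: "enat \<Rightarrow> nat letter list monoid" where
  "FG r = free_group {i. enat i < r}"

definition word_length :: "'a letter list \<Rightarrow> nat" where
  "word_length w = length w"

definition radial :: "enat \<Rightarrow> (nat letter list \<Rightarrow> 'b) \<Rightarrow> bool" where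
  "radial r \<psi> \<longleftrightarrow>
     (\<forall>x\<in>carrier (FG r). \<forall>y\<in>carrier (FG r). word_length x = word_length y \<longrightarrow> \<psi> x = \<psi> y)"

text \<open>
  In the order on \<^typ>\<open>complex\<close> used here, \<open>z \<le> 0\<close> means that \<open>z\<close> is real and nonpositive.
\<close>

definition cond_negative_definite :: "('a, 'b) monoid_scheme \<Rightarrow> ('a \<Rightarrow> complex) \<Rightarrow> bool" where
  "cond_negative_definite G \<psi> \<longleftrightarrow>
     (\<forall>x\<in>carrier G. \<psi> (inv\<^bsub>G\<^esub> x) = cnj (\<psi> x)) \<and>
     (\<forall>(n::nat) (x::nat \<Rightarrow> 'a) (c::nat \<Rightarrow> complex).
        (\<forall>j\<in>{1..n}. x j \<in> carrier G) \<longrightarrow> (\<Sum>j=1..n. c j) = 0 \<longrightarrow>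
        (\<Sum>j=1..n. \<Sum>k=1..n. c j * cnj (c k) * \<psi> (inv\<^bsub>G\<^esub> (x k) \<otimes>\<^bsub>G\<^esub> x j)) \<le> 0)"

subsection \<open>\<open>free_group S\<close> is the free group on \<open>S\<close>\<close>

lemma letter_inv_simps [simp]:
  "letter_inv (letter_inv a) = a" "fst (letter_inv a) = fst a" "letter_inv a \<noteq> a"
  "letter_inv a = letter_inv b \<longleftrightarrow> a = b"
  by (auto simp: letter_inv_def prod_eq_iff)

lemma reduced_simps [simp]:
  "reduced []" "reduced [a]"
  "reduced (a # b # w) \<longleftrightarrow> b \<noteq> letter_inv a \<and> reduced (b # w)"
  by (auto simp: reduced_def)

lemma reduced_tl: "reduced (a # w) \<Longrightarrow> reduced w"
  by (cases w) auto

lemma reduced_prepend: "reduced w \<Longrightarrow> reduced (prepend a w)"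
  by (cases w) (auto dest: reduced_tl)

lemma reduced_mult_word: "reduced w \<Longrightarrow> reduced (mult_word v w)"
  by (induction v) (auto simp: mult_word_def intro: reduced_prepend)

lemma prepend_reduced: "reduced (a # w) \<Longrightarrow> prepend a w = a # w"
  by (cases w) auto

lemma prepend_letter_inv:
  assumes "reduced w"
  shows "prepend a (prepend (letter_inv a) w) = w"
proof (cases w)
  case (Cons b u)
  then show ?thesis using assms by (cases "b = a") (auto simp: prepend_reduced)
qed simp

lemma mult_word_prepend:
  assumes "reduced z"
  shows "mult_word (prepend a w) z = prepend a (mult_word w z)"
proof (cases w)
  case (Cons b u)
  then show ?thesis
    using prepend_letter_inv[of "mult_word u z" a] reduced_mult_word[OF assms]
    by (auto simp: mult_word_def)
qed (simp add: mult_word_def)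

lemma mult_word_assoc:
  "reduced z \<Longrightarrow> mult_word (mult_word x y) z = mult_word x (mult_word y z)"
proof (induction x)
  case (Cons a x)
  have "mult_word (mult_word (a # x) y) z = mult_word (prepend a (mult_word x y)) z"
    by (simp add: mult_word_def)
  also have "\<dots> = prepend a (mult_word (mult_word x y) z)"
    using Cons.prems by (rule mult_word_prepend)
  also have "\<dots> = mult_word (a # x) (mult_word y z)"
    using Cons by (simp add: mult_word_def)
  finally show ?case .
qed (simp add: mult_word_def)

lemma mult_word_Nil: "reduced w \<Longrightarrow> mult_word w [] = w"
proof (induction w)
  case (Cons a w)
  then show ?case using reduced_tl[of a w] prepend_reduced[of a w] by (simp add: mult_word_def)
qed (simp add: mult_word_def)

lemma reduced_inverse: "reduced w \<Longrightarrow> reduced (rev (map letter_inv w))"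
  by (auto simp: reduced_def successively_map elim!: successively_mono)

lemma mult_word_inverse:
  "reduced z \<Longrightarrow> mult_word (rev (map letter_inv w)) (mult_word w z) = z"
proof (induction w)
  case (Cons a w)
  have "prepend (letter_inv a) (prepend a (mult_word w z)) = mult_word w z"
    using prepend_letter_inv[of "mult_word w z" "letter_inv a"] reduced_mult_word[OF Cons.prems]
    by simp
  then show ?case using Cons by (simp add: mult_word_def)
qed (simp add: mult_word_def)

lemma set_prepend: "set (prepend a w) \<subseteq> insert a (set w)"
  by (cases w) auto

lemma set_mult_word: "set (mult_word v w) \<subseteq> set v \<union> set w"
proof (induction v)
  case (Cons a v)
  then show ?case using set_prepend[of a "mult_word v w"] by (auto simp: mult_word_def)
qed (simp add: mult_word_def)

lemma carrier_free_group: "w \<in> carrier (free_group S) \<longleftrightarrow> reduced w \<and> fst ` set w \<subseteq> S"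
  by (simp add: free_group_def)

lemma free_group_simps [simp]:
  "\<one>\<^bsub>free_group S\<^esub> = []" "v \<otimes>\<^bsub>free_group S\<^esub> w = mult_word v w"
  by (simp_all add: free_group_def)

lemma group_free_group: "group (free_group S)"
proof (rule groupI)
  fix x y assume "x \<in> carrier (free_group S)" "y \<in> carrier (free_group S)"
  then show "x \<otimes>\<^bsub>free_group S\<^esub> y \<in> carrier (free_group S)"
    using set_mult_word[of x y] by (fastforce simp: carrier_free_group reduced_mult_word)
next
  fix x assume x: "x \<in> carrier (free_group S)"
  then show "\<exists>y\<in>carrier (free_group S). y \<otimes>\<^bsub>free_group S\<^esub> x = \<one>\<^bsub>free_group S\<^esub>"
    using mult_word_inverse[of "[]" x]
    by (intro bexI[of _ "rev (map letter_inv x)"])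
       (auto simp: carrier_free_group reduced_inverse mult_word_Nil)
qed (auto simp: carrier_free_group mult_word_assoc, simp add: mult_word_def)

lemma inv_free_group:
  assumes "w \<in> carrier (free_group S)"
  shows "inv\<^bsub>free_group S\<^esub> w = rev (map letter_inv w)"
proof -
  interpret group "free_group S" by (rule group_free_group)
  show ?thesis
    using assms mult_word_inverse[of "[]" w]
    by (intro inv_equality) (auto simp: carrier_free_group reduced_inverse mult_word_Nil)
qed

lemma group_FG: "group (FG r)"
  unfolding FG_def by (rule group_free_group)

text \<open>The universal property: a map from \<open>S\<close> into a group extends uniquely to a homomorphism.\<close>

lemma free_group_universal:
  fixes S :: "'a set" and H (structure)
  assumes "group H" and f: "f \<in> S \<rightarrow> carrier H"
  shows "\<exists>h\<in>hom (free_group S) H. \<forall>s\<in>S. h [(s, True)] = f s"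
    and "\<lbrakk>h \<in> hom (free_group S) H; h' \<in> hom (free_group S) H;
          \<forall>s\<in>S. h [(s, True)] = f s; \<forall>s\<in>S. h' [(s, True)] = f s;
          w \<in> carrier (free_group S)\<rbrakk> \<Longrightarrow> h w = h' w"
proof -
  interpret H: group H by fact
  define g where "g a = (if snd a then f (fst a) else inv f (fst a))" for a :: "'a letter"
  define k where "k w = foldr (\<lambda>a y. g a \<otimes> y) w \<one>" for w
  have g: "g a \<in> carrier H" if "fst a \<in> S" for a
    using that f by (auto simp: g_def)
  have g_inv: "g (letter_inv a) = inv g a" if "fst a \<in> S" for a
    using that f by (auto simp: g_def letter_inv_def Pi_iff)
  have k: "k w \<in> carrier H" if "fst ` set w \<subseteq> S" for w
    using that by (induction w) (auto simp: k_def g)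
  have k_Cons: "k (a # w) = g a \<otimes> k w" for a w by (simp add: k_def)
  have k_prepend: "k (prepend a w) = g a \<otimes> k w" if "fst a \<in> S" "fst ` set w \<subseteq> S" for a w
  proof (cases w)
    case (Cons b u)
    have ku: "k u \<in> carrier H" using that Cons k by auto
    have "g a \<otimes> (inv g a \<otimes> k u) = k u"
      using that(1) g ku by (simp add: H.m_assoc[symmetric])
    then show ?thesis using Cons that by (auto simp: k_Cons g_inv)
  qed (simp add: k_Cons)
  have k_mult: "k (mult_word v w) = k v \<otimes> k w"
    if "fst ` set v \<subseteq> S" "fst ` set w \<subseteq> S" for v w
    using that
  proof (induction v)
    case Nil
    then show ?case using k by (simp add: mult_word_def k_def)
  next
    case (Cons a v)
    have "fst ` set (mult_word v w) \<subseteq> S"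
      using Cons.prems set_mult_word[of v w] by fastforce
    moreover have "mult_word (a # v) w = prepend a (mult_word v w)"
      by (simp add: mult_word_def)
    ultimately show ?case using Cons k g by (simp add: k_prepend k_Cons H.m_assoc)
  qed
  have "k \<in> hom (free_group S) H"
    by (rule homI) (auto simp: carrier_free_group k k_mult)
  moreover have "k [(s, True)] = f s" if "s \<in> S" for s
    using that f by (auto simp: k_def g_def Pi_iff)
  ultimately show "\<exists>h\<in>hom (free_group S) H. \<forall>s\<in>S. h [(s, True)] = f s" by blast

  have eq: "h w = k w"
    if h: "h \<in> hom (free_group S) H" and hf: "\<forall>s\<in>S. h [(s, True)] = f s"
      and w: "w \<in> carrier (free_group S)" for h w
  proof -
    interpret hom: group_hom "free_group S" H h
      using h group_free_group \<open>group H\<close> by (simp add: group_hom_def group_hom_axioms_def)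
    have h_letter: "h [a] = g a" if "fst a \<in> S" for a
    proof (cases a)
      case (Pair s b)
      have s: "[(s, True)] \<in> carrier (free_group S)"
        using that Pair by (simp add: carrier_free_group)
      have "[(s, False)] = inv\<^bsub>free_group S\<^esub> [(s, True)]"
        using s by (simp add: inv_free_group letter_inv_def)
      then show ?thesis using that Pair s hf by (cases b) (auto simp: g_def hom.hom_inv)
    qed
    from w show ?thesis
    proof (induction w)
      case Nil
      then show ?case using hom.hom_one by (simp add: k_def)
    next
      case (Cons a w)
      have c: "[a] \<in> carrier (free_group S)" "w \<in> carrier (free_group S)"
        using Cons.prems reduced_tl[of a w] by (auto simp: carrier_free_group)
      have "a # w = [a] \<otimes>\<^bsub>free_group S\<^esub> w"
        using Cons.prems by (simp add: mult_word_def carrier_free_group prepend_reduced)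
      then have "h (a # w) = h [a] \<otimes> h w" using hom.hom_mult[OF c] by simp
      then show ?case using Cons.IH c h_letter by (auto simp: k_Cons carrier_free_group)
    qed
  qed
  show "\<lbrakk>h \<in> hom (free_group S) H; h' \<in> hom (free_group S) H;
          \<forall>s\<in>S. h [(s, True)] = f s; \<forall>s\<in>S. h' [(s, True)] = f s;
          w \<in> carrier (free_group S)\<rbrakk> \<Longrightarrow> h w = h' w"
    using eq[of h w] eq[of h' w] by simp
qed

text \<open>
  The length of a reduced word is the least number of generators and inverses of generators
  whose product is that word.
\<close>

lemma word_length_minimal:
  assumes w: "w \<in> carrier (free_group S)"
  shows "word_length w = (LEAST n. \<exists>l. length l = n \<and> fst ` set l \<subseteq> S \<and>
           w = foldr (\<lambda>a v. [a] \<otimes>\<^bsub>free_group S\<^esub> v) l \<one>\<^bsub>free_group S\<^esub>)"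
proof -
  have eq: "foldr (\<lambda>a v. [a] \<otimes>\<^bsub>free_group S\<^esub> v) l \<one>\<^bsub>free_group S\<^esub> = mult_word l []" for l
    by (simp add: mult_word_def)
  have le: "length (mult_word l []) \<le> length l" for l :: "'a letter list"
  proof (induction l)
    case (Cons a l)
    have "length (prepend a v) \<le> Suc (length v)" for v by (cases v) auto
    from this[of "mult_word l []"] Cons show ?case by (simp add: mult_word_def)
  qed (simp add: mult_word_def)
  show ?thesis
    unfolding eq word_length_def
    using w mult_word_Nil[of w] le
    by (intro Least_equality[symmetric]) (auto simp: carrier_free_group intro!: exI[of _ w])
qed

end

theory Submission
  imports Defs "HOL-Analysis.Summation_Tests" "HOL-Real_Asymp.Real_Asymp"
begin

text \<open>
  Let \<open>a, b\<close> be two of the generators and \<open>f n = sqrt (\<psi> (a ^ n))\<close>, so that \<open>\<psi> x = (f \<bar>x\<bar>)\<^sup>2\<close>.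
  By Schoenberg, \<open>\<psi> (x\<^sup>-\<^sup>1 y)\<close> is a squared Hilbert space distance, which makes \<open>f\<close> subadditive.
  The points \<open>a ^ i b ^ m\<close> with \<open>i < k\<close> are at distance \<open>m + i\<close> from \<open>e\<close> and at distance
  \<open>2 m + \<bar>i - j\<bar>\<close> from each other, and in Hilbert space the mean squared distance between two
  of them is at most twice their mean squared distance from any centre. Hence \<open>(f (2 m))\<^sup>2\<close> is
  at most \<open>2 (1 + 1 / (k - 1)) (f m)\<^sup>2\<close> up to an error of order \<open>k\<close> in \<open>f\<close>. Letting \<open>k\<close> grow
  slowly with \<open>m\<close>, the errors along dyadic scales are summable, so \<open>(f n)\<^sup>2\<close> grows at most linearly.
\<close>

section \<open>Metric inequalities for conditionally negative definite functions\<close>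

text \<open>Enumerating \<open>I\<close> by \<open>{1..card I}\<close> frees the defining inequality
  from numbered families, so weights can be placed on whatever index type describes the
  configuration.\<close>

lemma cond_negative_definite_sum:
  fixes \<psi> :: "'a \<Rightarrow> real" and c :: "'i \<Rightarrow> real" and x :: "'i \<Rightarrow> 'a"
  assumes "cond_negative_definite G (\<lambda>x. complex_of_real (\<psi> x))"
    and "finite I" "\<And>i. i \<in> I \<Longrightarrow> x i \<in> carrier G" "sum c I = 0"
  shows "(\<Sum>i\<in>I. \<Sum>j\<in>I. c i * c j * \<psi> (inv\<^bsub>G\<^esub> (x j) \<otimes>\<^bsub>G\<^esub> x i)) \<le> 0"
proof -
  obtain h where h: "bij_betw h {1..card I} I"
    using ex_bij_betw_nat_finite_1[OF assms(2)] by blast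
  have eq: "sum g I = (\<Sum>k=1..card I. g (h k))" for g :: "'i \<Rightarrow> real"
    using sum.reindex_bij_betw[OF h, of g] by simp
  have x: "\<forall>k\<in>{1..card I}. x (h k) \<in> carrier G"
    using bij_betwE[OF h] assms(3) by blast
  have "(\<Sum>k=1..card I. complex_of_real (c (h k))) = 0"
    using assms(4) unfolding eq by (simp flip: of_real_sum)
  with x have "(\<Sum>j=1..card I. \<Sum>k=1..card I. complex_of_real (c (h j)) * cnj (complex_of_real (c (h k)))
        * complex_of_real (\<psi> (inv\<^bsub>G\<^esub> (x (h k)) \<otimes>\<^bsub>G\<^esub> x (h j)))) \<le> 0"
    using assms(1) unfolding cond_negative_definite_def
    by (elim conjE allE[of _ "card I"] allE[of _ "\<lambda>k. x (h k)"]
      allE[of _ "\<lambda>k. complex_of_real (c (h k))"]) auto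
  then have "complex_of_real (\<Sum>j=1..card I. \<Sum>k=1..card I. c (h j) * c (h k)
        * \<psi> (inv\<^bsub>G\<^esub> (x (h k)) \<otimes>\<^bsub>G\<^esub> x (h j))) \<le> 0"
    by simp
  then show ?thesis
    unfolding eq by (simp only: less_eq_complex_def Re_complex_of_real zero_complex.sel)
qed

text \<open>As \<open>\<psi>\<close> is real, the Hermitian condition says that it takes the same
  value at a group element and at its inverse.\<close>

lemma cond_negative_definite_commute:
  assumes "group G" "cond_negative_definite G (\<lambda>x. complex_of_real (\<psi> x))"
    and "x \<in> carrier G" "y \<in> carrier G"
  shows "\<psi> (inv\<^bsub>G\<^esub> x \<otimes>\<^bsub>G\<^esub> y) = \<psi> (inv\<^bsub>G\<^esub> y \<otimes>\<^bsub>G\<^esub> x)"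
proof -
  interpret group G by fact
  have "\<psi> (inv\<^bsub>G\<^esub> (inv\<^bsub>G\<^esub> x \<otimes>\<^bsub>G\<^esub> y)) = \<psi> (inv\<^bsub>G\<^esub> x \<otimes>\<^bsub>G\<^esub> y)"
    using assms(2-4) by (simp add: cond_negative_definite_def)
  then show ?thesis using assms(3,4) by (simp add: inv_mult_group)
qed

lemma cond_negative_definite_nonneg:
  assumes "group G" and cnd: "cond_negative_definite G (\<lambda>x. complex_of_real (\<psi> x))"
    and one: "\<psi> \<one>\<^bsub>G\<^esub> = 0" and x: "x \<in> carrier G"
  shows "0 \<le> \<psi> x"
proof -
  interpret group G by fact
  have "\<psi> (inv\<^bsub>G\<^esub> x) = \<psi> x" using cnd x by (simp add: cond_negative_definite_def)
  then show ?thesis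
    using cond_negative_definite_sum[OF cnd, of "UNIV :: bool set" "\<lambda>b. if b then x else \<one>\<^bsub>G\<^esub>"
        "\<lambda>b. if b then 1 else - 1"] x one
    by (simp add: UNIV_bool)
qed

text \<open>This is the triangle inequality for Schoenberg's distance, drawn from a single choice of
  weights on three points, without constructing the Hilbert space.\<close>

lemma sqrt_cond_negative_definite_triangle:
  assumes "group G" and cnd: "cond_negative_definite G (\<lambda>x. complex_of_real (\<psi> x))"
    and one: "\<psi> \<one>\<^bsub>G\<^esub> = 0"
    and xyz: "x \<in> carrier G" "y \<in> carrier G" "z \<in> carrier G"
  shows "sqrt (\<psi> (inv\<^bsub>G\<^esub> x \<otimes>\<^bsub>G\<^esub> z))
    \<le> sqrt (\<psi> (inv\<^bsub>G\<^esub> x \<otimes>\<^bsub>G\<^esub> y)) + sqrt (\<psi> (inv\<^bsub>G\<^esub> y \<otimes>\<^bsub>G\<^esub> z))"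
proof -
  interpret group G by fact
  define D where "D u v = \<psi> (inv\<^bsub>G\<^esub> u \<otimes>\<^bsub>G\<^esub> v)" for u v
  have comm: "D u v = D v u" and nonneg: "0 \<le> D u v" and refl: "D u u = 0"
    if "u \<in> carrier G" "v \<in> carrier G" for u v
    using cond_negative_definite_commute[OF assms(1) cnd that] that one
      cond_negative_definite_nonneg[OF assms(1) cnd one] by (auto simp: D_def)
  have "sqrt (D x z) \<le> sqrt (D x y) + sqrt (D y z) + e" if e: "0 < e" for e
  proof -
    \<comment> \<open>Weights proportional to the opposite side lengths are optimal; \<open>e\<close> keeps them positive.\<close>
    define a b where "a = sqrt (D y z) + e / 2" and "b = sqrt (D x y) + e / 2"
    have ab: "0 < a" "0 < b" using e nonneg xyz by (auto simp: a_def b_def intro: add_nonneg_pos)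
    have "sqrt (D y z) \<le> a" "sqrt (D x y) \<le> b" using e by (auto simp: a_def b_def)
    then have sq: "D y z \<le> a\<^sup>2" "D x y \<le> b\<^sup>2" by (auto dest: sqrt_le_D)
    define w where "w i = (if i = 0 then x else if i = 1 then y else z)" for i :: nat
    define c where "c i = (if i = 0 then a else if i = 1 then - (a + b) else b)" for i :: nat
    have "(\<Sum>i\<in>{0, 1, 2::nat}. \<Sum>j\<in>{0, 1, 2}. c i * c j * D (w j) (w i)) \<le> 0"
      unfolding D_def
      by (rule cond_negative_definite_sum[OF cnd]) (use xyz in \<open>auto simp: w_def c_def\<close>)
    then have "a * b * D x z \<le> (a + b) * (a * D x y + b * D y z)"
      using comm[of x y] comm[of y z] comm[of x z] xyz
      by (simp add: w_def c_def refl algebra_simps)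
    also have "\<dots> \<le> (a + b) * (a * b\<^sup>2 + b * a\<^sup>2)"
      using ab sq by (intro mult_left_mono add_mono) auto
    also have "\<dots> = a * b * (a + b)\<^sup>2" by (simp add: power2_eq_square algebra_simps)
    finally have "D x z \<le> (a + b)\<^sup>2" using ab by simp
    then have "sqrt (D x z) \<le> a + b" using ab real_le_lsqrt[of "a + b"] by simp
    then show ?thesis by (simp add: a_def b_def)
  qed
  then show ?thesis unfolding D_def by (rule field_le_epsilon)
qed

text \<open>Weight 1 on each \<open>x i\<close> is balanced by weight \<open>- card I\<close> on the
  identity, which serves as the centre.\<close>

lemma cond_negative_definite_average:
  fixes \<psi> :: "'a \<Rightarrow> real" and x :: "'i \<Rightarrow> 'a"
  assumes "group G" and cnd: "cond_negative_definite G (\<lambda>x. complex_of_real (\<psi> x))"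
    and one: "\<psi> \<one>\<^bsub>G\<^esub> = 0"
    and I: "finite I" and x: "\<And>i. i \<in> I \<Longrightarrow> x i \<in> carrier G"
  shows "(\<Sum>i\<in>I. \<Sum>j\<in>I. \<psi> (inv\<^bsub>G\<^esub> (x j) \<otimes>\<^bsub>G\<^esub> x i)) \<le> 2 * real (card I) * (\<Sum>i\<in>I. \<psi> (x i))"
proof -
  interpret group G by fact
  \<comment> \<open>The centre gets an index of its own, \<open>None\<close>, so some
    \<open>x i\<close> may coincide with the identity.\<close>
  let ?I = "insert None (Some ` I)"
  define c where "c t = (case t of None \<Rightarrow> - real (card I) | Some i \<Rightarrow> 1)" for t :: "'i option"
  define w where "w t = (case t of None \<Rightarrow> \<one>\<^bsub>G\<^esub> | Some i \<Rightarrow> x i)" for t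
  have split: "sum g ?I = g None + (\<Sum>i\<in>I. g (Some i))" for g :: "'i option \<Rightarrow> real"
    using I by (simp add: sum.reindex)
  have inv: "\<psi> (inv\<^bsub>G\<^esub> (x i)) = \<psi> (x i)" if "i \<in> I" for i
    using cnd x[OF that] by (simp add: cond_negative_definite_def)
  have "(\<Sum>s\<in>?I. \<Sum>t\<in>?I. c s * c t * \<psi> (inv\<^bsub>G\<^esub> (w t) \<otimes>\<^bsub>G\<^esub> w s)) \<le> 0"
  proof (rule cond_negative_definite_sum[OF cnd])
    show "sum c ?I = 0" unfolding split by (simp add: c_def)
  qed (use I x in \<open>auto simp: w_def\<close>)
  then show ?thesis
    unfolding split using x one inv
    by (simp add: c_def w_def sum.distrib sum_subtractf sum_negf flip: sum_distrib_left)
qed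

section \<open>Lengths of words in two free generators\<close>

lemma mult_word_append: "mult_word (u @ v) w = mult_word u (mult_word v w)"
  by (simp add: mult_word_def)

lemma mult_word_reduced_append: "reduced (u @ v) \<Longrightarrow> mult_word u v = u @ v"
proof (induction u)
  case (Cons a u)
  then show ?case using reduced_tl[of a "u @ v"] prepend_reduced[of a "u @ v"]
    by (simp add: mult_word_def)
qed (simp add: mult_word_def)

lemma mult_word_cancel_prefix:
  assumes "reduced (p @ v)"
  shows "mult_word (rev (map letter_inv (p @ u))) (p @ v) = mult_word (rev (map letter_inv u)) v"
proof -
  have "reduced v" using assms by (simp add: reduced_def successively_append_iff)
  then show ?thesis
    using mult_word_inverse[of v p] mult_word_reduced_append[OF assms]
    by (simp add: mult_word_append)
qed

abbreviation gen_power :: "nat \<Rightarrow> nat \<Rightarrow> nat letter list" where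
  "gen_power g n \<equiv> replicate n (g, True)"

lemma successively_replicate: "P a a \<Longrightarrow> successively P (replicate n a)"
proof (induction n)
  case (Suc n)
  then show ?case by (cases n) auto
qed simp

lemma gen_power_carrier:
  assumes "2 \<le> r"
  shows "gen_power 0 i @ gen_power 1 m \<in> carrier (FG r)"
proof -
  have "enat 0 < r" "enat 1 < r"
    using assms by (cases r; simp add: numeral_eq_enat)+
  then show ?thesis
    by (auto simp: FG_def carrier_free_group reduced_def successively_append_iff
        successively_replicate letter_inv_def zero_enat_def one_enat_def)
qed

text \<open>The common prefix \<open>a^i\<close> cancels and leaves
  \<open>b^(-m) a^(j-i) b^m\<close>. Since \<open>i < j\<close>, a letter \<open>a\<close> separates
  the two powers of \<open>b\<close>, so nothing else cancels.\<close>

lemma word_length_gen_power_diff: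
  assumes r: "2 \<le> r" and "i < j"
  shows "word_length (inv\<^bsub>FG r\<^esub> (gen_power 0 i @ gen_power 1 m) \<otimes>\<^bsub>FG r\<^esub>
    (gen_power 0 j @ gen_power 1 m)) = 2 * m + (j - i)"
proof -
  let ?v = "gen_power 0 (j - i) @ gen_power 1 m"
  have j: "gen_power 0 j = gen_power 0 i @ gen_power 0 (j - i)"
    using \<open>i < j\<close> by (simp flip: replicate_add)
  have red: "reduced (gen_power 0 i @ ?v)"
    using gen_power_carrier[OF r, of j m] j by (simp add: FG_def carrier_free_group)
  have "reduced (rev (map letter_inv (gen_power 1 m)) @ ?v)"
    using \<open>i < j\<close>
    by (auto simp: reduced_def successively_append_iff successively_replicate letter_inv_def)
  then have "mult_word (rev (map letter_inv (gen_power 1 m))) ?v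
      = rev (map letter_inv (gen_power 1 m)) @ ?v"
    by (rule mult_word_reduced_append)
  then have "mult_word (rev (map letter_inv (gen_power 0 i @ gen_power 1 m))) (gen_power 0 i @ ?v)
      = rev (map letter_inv (gen_power 1 m)) @ ?v"
    using mult_word_cancel_prefix[OF red] by metis
  moreover have "inv\<^bsub>FG r\<^esub> (gen_power 0 i @ gen_power 1 m)
      = rev (map letter_inv (gen_power 0 i @ gen_power 1 m))"
    using gen_power_carrier[OF r] unfolding FG_def by (rule inv_free_group)
  ultimately show ?thesis
    unfolding j using \<open>i < j\<close> by (simp add: FG_def word_length_def)
qed

section \<open>Square root growth of subadditive sequences\<close>

lemma sqrt_growth_doubling:
  fixes f :: "nat \<Rightarrow> real"
  assumes nonneg: "\<And>n. 0 \<le> f n" and zero: "f 0 = 0"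
    and sub: "\<And>m n. f (m + n) \<le> f m + f n" and diff: "\<And>m n. f m \<le> f (m + n) + f n"
    and avg: "\<And>m k. (\<Sum>i<k. \<Sum>j<k. if i = j then 0 else (f (2 * m + (max i j - min i j)))\<^sup>2)
      \<le> 2 * real k * (\<Sum>i<k. (f (m + i))\<^sup>2)"
    and p: "1 \<le> p"
  shows "f (2 * m) \<le> sqrt 2 * (1 + 1 / real p) * f m + 4 * (real p + 1) * f 1"
proof -
  have lin: "f n \<le> real n * f 1" for n
  proof (induction n)
    case (Suc n)
    then show ?case using sub[of n 1] by (simp add: algebra_simps)
  qed (simp add: zero)
  \<comment> \<open>With \<open>k = p + 1\<close> points, the ratio \<open>k / (k - 1)\<close>
    becomes \<open>1 + 1 / p\<close>.\<close>
  define k where "k = Suc p"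
  \<comment> \<open>\<open>e\<close> bounds the change of \<open>f\<close> when its argument moves
    by less than \<open>k\<close>.\<close>
  define e where "e = real k * f 1"
  have e: "0 \<le> e" by (simp add: e_def nonneg)
  have small: "f n \<le> e" if "n < k" for n
  proof -
    have "real n * f 1 \<le> e" unfolding e_def using that nonneg by (intro mult_right_mono) auto
    then show ?thesis using lin[of n] by linarith
  qed
  define s where "s = sqrt 2 * (1 + 1 / real p)"
  have inv_p: "0 \<le> 1 / real p" "1 / real p \<le> 1" using p by auto
  \<comment> \<open>The crude bound 3 on \<open>s\<close> turns the total error
    \<open>e + s * e\<close> into \<open>4 * e\<close>.\<close>
  have "s \<le> (3/2) * 2"
    unfolding s_def using inv_p by (intro mult_mono real_le_lsqrt) (auto simp: power2_eq_square)
  moreover have s0: "0 \<le> s" by (simp add: s_def)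
  ultimately have s: "s * e \<le> 3 * e" using e by (intro mult_right_mono) auto
  have "f (2 * m) - e \<le> s * (f m + e)"
  proof (cases "f (2 * m) \<le> e")
    case True
    moreover have "0 \<le> s * (f m + e)" using e nonneg s0 by simp
    ultimately show ?thesis by linarith
  next
    case False
    \<comment> \<open>\<open>L\<close> bounds \<open>f\<close> from below at every distance between
      distinct points; its positivity, secured by the case split, allows squaring.\<close>
    define L where "L = f (2 * m) - e"
    have L: "0 < L" using False by (simp add: L_def)
    \<comment> \<open>There are \<open>k * (k - 1) = k * p\<close> ordered pairs off the
      diagonal.\<close>
    have "real p * (real k * L\<^sup>2) = (\<Sum>i<k. \<Sum>j<k. (L\<^sup>2 - (if i = j then L\<^sup>2 else 0)))"
      by (simp add: sum_subtractf k_def algebra_simps)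
    also have "\<dots> \<le> (\<Sum>i<k. \<Sum>j<k. if i = j then 0 else (f (2 * m + (max i j - min i j)))\<^sup>2)"
    proof (intro sum_mono)
      fix i j assume ij: "i \<in> {..<k}" "j \<in> {..<k}"
      have "max i j - min i j < k" using ij by auto
      then have "L \<le> f (2 * m + (max i j - min i j))"
        using diff[of "2 * m" "max i j - min i j"] small[of "max i j - min i j"]
        unfolding L_def by linarith
      then show "L\<^sup>2 - (if i = j then L\<^sup>2 else 0)
          \<le> (if i = j then 0 else (f (2 * m + (max i j - min i j)))\<^sup>2)"
        using L by (auto intro: power_mono)
    qed
    also have "\<dots> \<le> 2 * real k * (\<Sum>i<k. (f (m + i))\<^sup>2)" by (rule avg)
    also have "\<dots> \<le> 2 * real k * (\<Sum>i<k. (f m + e)\<^sup>2)"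
    proof (intro mult_left_mono sum_mono power_mono)
      fix i assume "i \<in> {..<k}"
      then show "f (m + i) \<le> f m + e" using sub[of m i] small[of i] by auto
    qed (auto simp: nonneg)
    also have "\<dots> = (2 * real k * (f m + e)\<^sup>2) * real k" by simp
    finally have "real p * L\<^sup>2 \<le> 2 * real k * (f m + e)\<^sup>2"
      by (simp add: k_def mult.assoc mult.left_commute[of "real p"])
    then have "L\<^sup>2 \<le> 2 * (1 + 1 / real p) * (f m + e)\<^sup>2"
      using p by (simp add: k_def field_simps)
    \<comment> \<open>Squaring the factor, which is at least 1, makes the right side the exact
      square of \<open>s * (f m + e)\<close>.\<close>
    also have "\<dots> \<le> 2 * (1 + 1 / real p)\<^sup>2 * (f m + e)\<^sup>2"
      using inv_p by (intro mult_right_mono mult_left_mono self_le_power) auto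
    also have "\<dots> = (s * (f m + e))\<^sup>2" by (simp add: s_def power_mult_distrib)
    finally have "L \<le> s * (f m + e)"
      using e nonneg s0 by (auto intro: power2_le_imp_le mult_nonneg_nonneg add_nonneg_nonneg)
    then show ?thesis by (simp add: L_def)
  qed
  then have "f (2 * m) \<le> s * f m + 4 * e" using s by (simp add: algebra_simps)
  then show ?thesis by (simp add: s_def e_def k_def algebra_simps)
qed

text \<open>A discrete Gronwall bound: \<open>1 + u n \<le> exp (u n)\<close> collects the factors
  into one exponential, which is at least 1 and so absorbs each \<open>v n\<close>.\<close>

lemma perturbed_recurrence_bounded:
  fixes g u v :: "nat \<Rightarrow> real"
  assumes rec: "\<And>n. g (Suc n) \<le> (1 + u n) * g n + v n"
    and u: "\<And>n. 0 \<le> u n" "summable u" and v: "\<And>n. 0 \<le> v n" "summable v" and "0 \<le> g 0"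
  shows "g n \<le> exp (suminf u) * (g 0 + suminf v)"
proof -
  have *: "g n \<le> exp (\<Sum>i<n. u i) * (g 0 + (\<Sum>i<n. v i))" for n
  proof (induction n)
    case (Suc n)
    have pos: "0 \<le> g 0 + (\<Sum>i<n. v i)" using v(1) \<open>0 \<le> g 0\<close> by (intro add_nonneg_nonneg sum_nonneg) auto
    have "(1 + u n) * g n \<le> (1 + u n) * (exp (\<Sum>i<n. u i) * (g 0 + (\<Sum>i<n. v i)))"
      using Suc u(1) by (intro mult_left_mono) auto
    also have "\<dots> \<le> exp (u n) * (exp (\<Sum>i<n. u i) * (g 0 + (\<Sum>i<n. v i)))"
      using pos by (intro mult_right_mono exp_ge_add_one_self) auto
    also have "\<dots> = exp (\<Sum>i<Suc n. u i) * (g 0 + (\<Sum>i<n. v i))" by (simp add: exp_add)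
    finally have "(1 + u n) * g n \<le> \<dots>" .
    moreover have "v n \<le> exp (\<Sum>i<Suc n. u i) * v n"
      using mult_right_mono[of 1 "exp (\<Sum>i<Suc n. u i)" "v n"] u(1) v(1)
      by (simp add: sum_nonneg del: sum.lessThan_Suc)
    ultimately show ?case using rec[of n] by (simp add: algebra_simps)
  qed simp
  also have "exp (\<Sum>i<n. u i) * (g 0 + (\<Sum>i<n. v i)) \<le> exp (suminf u) * (g 0 + suminf v)"
    using u v \<open>0 \<le> g 0\<close>
    by (intro mult_mono add_mono) (auto intro!: sum_le_suminf sum_nonneg add_nonneg_nonneg)
  finally show ?thesis .
qed

text \<open>Taking \<open>p = (j + 1)^2\<close> at scale \<open>2 ^ j\<close> makes the relative
  errors \<open>1 / p\<close> summable, while the additive errors, polynomial in \<open>j\<close>,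
  are summable after division by \<open>sqrt 2 ^ Suc j\<close>.\<close>

lemma sqrt_growth:
  fixes f :: "nat \<Rightarrow> real"
  assumes nonneg: "\<And>n. 0 \<le> f n" and zero: "f 0 = 0"
    and sub: "\<And>m n. f (m + n) \<le> f m + f n"
    and dbl: "\<And>m p. 1 \<le> p \<Longrightarrow>
      f (2 * m) \<le> sqrt 2 * (1 + 1 / real p) * f m + 4 * (real p + 1) * f 1"
  shows "\<exists>C. \<forall>n. f n \<le> C * sqrt (real n)"
proof -
  define u :: "nat \<Rightarrow> real" where "u j = 1 / real ((j + 1)\<^sup>2)" for j
  \<comment> \<open>The final \<open>+ 1\<close> pays for the remainder \<open>n mod 2\<close> when
    \<open>n\<close> is halved.\<close>
  define v where "v j = (4 * (real ((j + 1)\<^sup>2) + 1) + 1) * f 1 / sqrt 2 ^ Suc j" for j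
  have u: "0 \<le> u j" and v: "0 \<le> v j" for j using nonneg[of 1] by (auto simp: u_def v_def)
  have powr: "summable (\<lambda>j. norm (real j powr (- 2)))" by (simp add: summable_real_powr_iff)
  have "u \<in> O(\<lambda>j. real j powr (- 2))" unfolding u_def by real_asymp
  with powr have su: "summable u" by (rule summable_comparison_test_bigo)
  have "(\<lambda>j. (4 * (real ((j + 1)\<^sup>2) + 1) + 1) / sqrt 2 ^ Suc j) \<in> O(\<lambda>j. real j powr (- 2))"
    by real_asymp
  with powr have "summable (\<lambda>j. (4 * (real ((j + 1)\<^sup>2) + 1) + 1) / sqrt 2 ^ Suc j)"
    by (rule summable_comparison_test_bigo)
  then have "summable (\<lambda>j. f 1 * ((4 * (real ((j + 1)\<^sup>2) + 1) + 1) / sqrt 2 ^ Suc j))"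
    by (rule summable_mult)
  also have "(\<lambda>j. f 1 * ((4 * (real ((j + 1)\<^sup>2) + 1) + 1) / sqrt 2 ^ Suc j)) = v"
    unfolding v_def by (simp only: times_divide_eq_right mult.commute[of "f 1"])
  finally have sv: "summable v" .
  \<comment> \<open>\<open>g\<close> solves the recurrence with equality; it will dominate
    \<open>f n / sqrt 2 ^ j\<close> for all \<open>n < 2 ^ j\<close>.\<close>
  define g where "g = rec_nat 0 (\<lambda>j y. (1 + u j) * y + v j)"
  have g: "g 0 = 0" "g (Suc j) = (1 + u j) * g j + v j" for j by (simp_all add: g_def)
  define B where "B = exp (suminf u) * suminf v"
  have B: "g j \<le> B" for j
    using perturbed_recurrence_bounded[of g u v j] u v su sv by (simp add: g B_def)
  have scale: "f n \<le> sqrt 2 ^ j * g j" if "n < 2 ^ j" for n j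
    using that
  proof (induction j arbitrary: n)
    case 0
    then show ?case by (simp add: zero g)
  next
    case (Suc j)
    define p where "p = (j + 1)\<^sup>2"
    have "f n \<le> f (2 * (n div 2)) + f (n mod 2)" using sub[of "2 * (n div 2)" "n mod 2"] by simp
    moreover have "f (n mod 2) \<le> f 1"
      using nonneg[of 1] zero by (cases "even n") (auto simp: odd_iff_mod_2_eq_one)
    moreover have "f (2 * (n div 2)) \<le> sqrt 2 * (1 + 1 / real p) * f (n div 2) + 4 * (real p + 1) * f 1"
      by (rule dbl) (simp add: p_def)
    moreover have "sqrt 2 * (1 + u j) * f (n div 2) \<le> sqrt 2 * (1 + u j) * (sqrt 2 ^ j * g j)"
      using Suc u[of j] by (intro mult_left_mono) auto
    moreover have "sqrt 2 ^ Suc j * g (Suc j)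
        = sqrt 2 * (1 + u j) * (sqrt 2 ^ j * g j) + 4 * (real p + 1) * f 1 + f 1"
      by (simp add: g v_def p_def field_simps)
    ultimately show ?case unfolding p_def u_def by linarith
  qed
  have "f n \<le> (sqrt 2 * B) * sqrt (real n)" for n
  proof (cases "n = 0")
    case False
    \<comment> \<open>The upper bound on \<open>n\<close> feeds \<open>scale\<close>; the lower one
      turns \<open>sqrt 2 ^ j\<close> into \<open>sqrt n\<close>, at the cost of one factor
      \<open>sqrt 2\<close>.\<close>
    then obtain j where j: "2 ^ j \<le> n" "n < 2 ^ Suc j"
      using ex_power_ivl1[of 2 n] by auto
    have B0: "0 \<le> B" using B[of 0] by (simp add: g)
    have "f n \<le> sqrt 2 ^ Suc j * B"
      using mult_left_mono[OF B[of "Suc j"], of "sqrt 2 ^ Suc j"]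
      by (intro order_trans[OF scale[OF j(2)]]) simp
    also have "\<dots> = sqrt 2 * B * sqrt (real (2 ^ j))" by (simp add: real_sqrt_power)
    also have "\<dots> \<le> sqrt 2 * B * sqrt (real n)"
      using B0 j(1) by (intro mult_left_mono real_sqrt_le_mono of_nat_mono) auto
    finally show ?thesis .
  qed (simp add: zero)
  then show ?thesis by blast
qed

section \<open>From radial functions to sequences\<close>

theorem corollary5p5:
  fixes r :: enat and \<psi> :: "nat letter list \<Rightarrow> real"
  assumes "2 \<le> r"
    and "radial r \<psi>"
    and "cond_negative_definite (FG r) (\<lambda>x. complex_of_real (\<psi> x))"
    and "\<psi> \<one>\<^bsub>FG r\<^esub> = 0"
  shows "\<exists>c\<ge>0. \<forall>x\<in>carrier (FG r). \<psi> x \<le> c * real (word_length x)"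
proof -
  interpret group "FG r" by (rule group_FG)
  define w where "w i m = gen_power 0 i @ gen_power 1 m" for i m
  define f where "f n = sqrt (\<psi> (w n 0))" for n
  have w: "w i m \<in> carrier (FG r)" for i m
    unfolding w_def by (rule gen_power_carrier) fact
  have psi_nonneg: "0 \<le> \<psi> x" if "x \<in> carrier (FG r)" for x
    using cond_negative_definite_nonneg[OF group_FG assms(3,4) that] .
  have sq: "\<psi> x = (f (word_length x))\<^sup>2" if "x \<in> carrier (FG r)" for x
  proof -
    have "word_length x = word_length (w (word_length x) 0)"
      by (simp add: w_def word_length_def)
    then have "\<psi> x = \<psi> (w (word_length x) 0)"
      using assms(2) that w unfolding radial_def by blast
    then show ?thesis by (simp add: f_def psi_nonneg w)
  qed
  have nonneg: "0 \<le> f n" for n by (simp add: f_def psi_nonneg w)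
  have zero: "f 0 = 0" using assms(4) by (simp add: f_def w_def FG_def)
  have lt: "\<psi> (inv\<^bsub>FG r\<^esub> (w i m) \<otimes>\<^bsub>FG r\<^esub> w j m) = (f (2 * m + (j - i)))\<^sup>2" if "i < j" for i j m
    using sq[of "inv\<^bsub>FG r\<^esub> (w i m) \<otimes>\<^bsub>FG r\<^esub> w j m"] w
      word_length_gen_power_diff[OF assms(1) that] by (simp add: w_def)
  have comm: "\<psi> (inv\<^bsub>FG r\<^esub> (w i m) \<otimes>\<^bsub>FG r\<^esub> w j m) = \<psi> (inv\<^bsub>FG r\<^esub> (w j m) \<otimes>\<^bsub>FG r\<^esub> w i m)" for i j m
    using cond_negative_definite_commute[OF group_FG assms(3)] w by blast
  have dist: "\<psi> (inv\<^bsub>FG r\<^esub> (w i m) \<otimes>\<^bsub>FG r\<^esub> w j m)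
      = (if i = j then 0 else (f (2 * m + (max i j - min i j)))\<^sup>2)" for i j m
    using lt[of i j m] lt[of j i m] comm[of i m j] w assms(4) by (cases i j rule: linorder_cases) auto
  \<comment> \<open>For \<open>m = 0\<close> the points are powers of a single generator, and
    triangles among them give both \<open>sub\<close> and \<open>diff\<close>.\<close>
  have dist0: "sqrt (\<psi> (inv\<^bsub>FG r\<^esub> (w i 0) \<otimes>\<^bsub>FG r\<^esub> w j 0)) = f (max i j - min i j)" for i j
    unfolding dist by (auto simp: zero nonneg)
  have triangle: "f (max i k - min i k) \<le> f (max i j - min i j) + f (max j k - min j k)" for i j k
    using sqrt_cond_negative_definite_triangle[OF group_FG assms(3,4) w w w, of i 0 k 0 j 0]
    unfolding dist0 .
  have sub: "f (m + n) \<le> f m + f n" for m n using triangle[of 0 "m + n" m] by simp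
  have diff: "f m \<le> f (m + n) + f n" for m n using triangle[of 0 m "m + n"] by simp
  have avg: "(\<Sum>i<k. \<Sum>j<k. if i = j then 0 else (f (2 * m + (max i j - min i j)))\<^sup>2)
      \<le> 2 * real k * (\<Sum>i<k. (f (m + i))\<^sup>2)" for m k
  proof -
    have "\<psi> (w i m) = (f (m + i))\<^sup>2" for i
      using sq[OF w[of i m]] by (simp add: w_def word_length_def add.commute)
    moreover have "\<psi> (inv\<^bsub>FG r\<^esub> (w j m) \<otimes>\<^bsub>FG r\<^esub> w i m)
        = (if i = j then 0 else (f (2 * m + (max i j - min i j)))\<^sup>2)" for i j
      using dist comm by metis
    ultimately show ?thesis
      using cond_negative_definite_average[OF group_FG assms(3,4), of "{..<k}" "\<lambda>i. w i m"] w
      by simp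
  qed
  obtain C where C: "\<And>n. f n \<le> C * sqrt (real n)"
    using sqrt_growth[OF nonneg zero sub sqrt_growth_doubling[OF nonneg zero sub diff avg]] by blast
  show ?thesis
  proof (intro exI[of _ "C\<^sup>2"] conjI ballI)
    fix x assume x: "x \<in> carrier (FG r)"
    have "\<psi> x \<le> (C * sqrt (real (word_length x)))\<^sup>2"
      unfolding sq[OF x] using C nonneg by (intro power_mono)
    then show "\<psi> x \<le> C\<^sup>2 * real (word_length x)" by (simp add: power_mult_distrib)
  qed simp
qed

end
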